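(* Let $S$ and $R$ be nonzero associative rings with identity, let $M$ be an $(S,R)$-bimodule, and let $T=\begin{pmatrix} S & M\\ 0 & R\end{pmatrix}$ be the corresponding generalized triangular matrix ring. Let $J=\begin{pmatrix} I & N\\ 0 & L\end{pmatrix}$ be an ideal of $T$. Then $J$ is a $z^{\circ}$-ideal of $T$ if and only if (i) $N=M$, and (ii) $I$ and $L$ are $z^{\circ}$-ideals of $S$ and $R$, respectively.
   Context: "Ideal" means two-sided ideal. $T$ consists of formal matrices $\begin{pmatrix} s & m\\ 0 & r\end{pmatrix}$ with $s\in S$, $m\in M$, $r\in R$, with the usual matrix operations. Every ideal of $T$ has the form $\begin{pmatrix} I & N\\ 0 & L\end{pmatrix}$, where $I$ is an ideal of $S$, $L$ is an ideal of $R$ and $N$ is a sub-bimodule of $M$ containing $IM+ML$. For an element $a$ of a ring, $P_a$ is the intersection of all minimal prime ideals of that ring containing $a$ (an empty intersection is the whole ring). An ideal $I$ of a ring is a $z^{\circ}$-ideal if $P_a\subseteq I$ for every $a\in I$. *)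

theory Defs
  imports "HOL-Algebra.Module" "HOL-Algebra.Ideal_Product"
begin

text \<open>
  The left action is \<open>smult\<close> of the library record \<open>module\<close>; the right action is the new field
  \<open>rsmult\<close>. As for library modules, the fields \<open>mult\<close> and \<open>one\<close> of the record carry no meaning.
  The library locale \<open>module\<close> is not reused because it requires a commutative ring.
\<close>

record ('s, 'm, 'r) bimodule = "('s, 'm) module" +
  rsmult :: "'m \<Rightarrow> 'r \<Rightarrow> 'm"

locale bimodule = S?: ring S + R?: ring R + M?: abelian_group M
  for S :: "('s, 'x) ring_scheme" and R :: "('r, 'y) ring_scheme"
    and M :: "('s, 'm, 'r, 'z) bimodule_scheme" +
  assumes lact_closed:
      "\<lbrakk> s \<in> carrier S; m \<in> carrier M \<rbrakk> \<Longrightarrow> smult M s m \<in> carrier M"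
    and lact_distr_scalar:
      "\<lbrakk> s \<in> carrier S; s' \<in> carrier S; m \<in> carrier M \<rbrakk> \<Longrightarrow>
        smult M (s \<oplus>\<^bsub>S\<^esub> s') m = smult M s m \<oplus>\<^bsub>M\<^esub> smult M s' m"
    and lact_distr:
      "\<lbrakk> s \<in> carrier S; m \<in> carrier M; m' \<in> carrier M \<rbrakk> \<Longrightarrow>
        smult M s (m \<oplus>\<^bsub>M\<^esub> m') = smult M s m \<oplus>\<^bsub>M\<^esub> smult M s m'"
    and lact_assoc:
      "\<lbrakk> s \<in> carrier S; s' \<in> carrier S; m \<in> carrier M \<rbrakk> \<Longrightarrow>
        smult M (s \<otimes>\<^bsub>S\<^esub> s') m = smult M s (smult M s' m)"
    and lact_one: "m \<in> carrier M \<Longrightarrow> smult M \<one>\<^bsub>S\<^esub> m = m"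
    and ract_closed:
      "\<lbrakk> m \<in> carrier M; r \<in> carrier R \<rbrakk> \<Longrightarrow> rsmult M m r \<in> carrier M"
    and ract_distr_scalar:
      "\<lbrakk> m \<in> carrier M; r \<in> carrier R; r' \<in> carrier R \<rbrakk> \<Longrightarrow>
        rsmult M m (r \<oplus>\<^bsub>R\<^esub> r') = rsmult M m r \<oplus>\<^bsub>M\<^esub> rsmult M m r'"
    and ract_distr:
      "\<lbrakk> m \<in> carrier M; m' \<in> carrier M; r \<in> carrier R \<rbrakk> \<Longrightarrow>
        rsmult M (m \<oplus>\<^bsub>M\<^esub> m') r = rsmult M m r \<oplus>\<^bsub>M\<^esub> rsmult M m' r"
    and ract_assoc:
      "\<lbrakk> m \<in> carrier M; r \<in> carrier R; r' \<in> carrier R \<rbrakk> \<Longrightarrow>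
        rsmult M m (r \<otimes>\<^bsub>R\<^esub> r') = rsmult M (rsmult M m r) r'"
    and ract_one: "m \<in> carrier M \<Longrightarrow> rsmult M m \<one>\<^bsub>R\<^esub> = m"
    and lact_ract:
      "\<lbrakk> s \<in> carrier S; m \<in> carrier M; r \<in> carrier R \<rbrakk> \<Longrightarrow>
        rsmult M (smult M s m) r = smult M s (rsmult M m r)"

text \<open>
  The triple \<open>(s, m, r)\<close> stands for the formal matrix with first row \<open>s, m\<close> and second row
  \<open>0, r\<close>. Accordingly \<open>I \<times> N \<times> L\<close> is the set of matrices with entries in \<open>I\<close>, \<open>N\<close>, \<open>L\<close>.
\<close>

definition triangular_ring ::
  "('s, 'x) ring_scheme \<Rightarrow> ('s, 'm, 'r, 'z) bimodule_scheme \<Rightarrow> ('r, 'y) ring_scheme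
    \<Rightarrow> ('s \<times> 'm \<times> 'r) ring"
  where "triangular_ring S M R =
    \<lparr> carrier = carrier S \<times> carrier M \<times> carrier R,
      mult = (\<lambda>(s, m, r) (s', m', r').
        (s \<otimes>\<^bsub>S\<^esub> s', smult M s m' \<oplus>\<^bsub>M\<^esub> rsmult M m r', r \<otimes>\<^bsub>R\<^esub> r')),
      one = (\<one>\<^bsub>S\<^esub>, \<zero>\<^bsub>M\<^esub>, \<one>\<^bsub>R\<^esub>),
      zero = (\<zero>\<^bsub>S\<^esub>, \<zero>\<^bsub>M\<^esub>, \<zero>\<^bsub>R\<^esub>),
      add = (\<lambda>(s, m, r) (s', m', r').
        (s \<oplus>\<^bsub>S\<^esub> s', m \<oplus>\<^bsub>M\<^esub> m', r \<oplus>\<^bsub>R\<^esub> r')) \<rparr>"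

lemma (in bimodule) lact_zero:
  assumes "s \<in> carrier S" shows "smult M s \<zero>\<^bsub>M\<^esub> = \<zero>\<^bsub>M\<^esub>"
  using lact_distr[OF assms M.zero_closed M.zero_closed] lact_closed[OF assms M.zero_closed]
  by (simp add: M.add.r_cancel_one')

lemma (in bimodule) ract_zero:
  assumes "r \<in> carrier R" shows "rsmult M \<zero>\<^bsub>M\<^esub> r = \<zero>\<^bsub>M\<^esub>"
  using ract_distr[OF M.zero_closed M.zero_closed assms] ract_closed[OF M.zero_closed assms]
  by (simp add: M.add.r_cancel_one')

lemma (in bimodule) lact_zero_scalar:
  assumes "m \<in> carrier M" shows "smult M \<zero>\<^bsub>S\<^esub> m = \<zero>\<^bsub>M\<^esub>"
  using lact_distr_scalar[OF S.zero_closed S.zero_closed assms] lact_closed[OF S.zero_closed assms]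
  by (simp add: M.add.r_cancel_one')

lemma (in bimodule) ract_zero_scalar:
  assumes "m \<in> carrier M" shows "rsmult M m \<zero>\<^bsub>R\<^esub> = \<zero>\<^bsub>M\<^esub>"
  using ract_distr_scalar[OF assms R.zero_closed R.zero_closed] ract_closed[OF assms R.zero_closed]
  by (simp add: M.add.r_cancel_one')

lemma (in bimodule) triangular_ring_is_ring: "ring (triangular_ring S M R)"
proof (rule ringI)
  show "abelian_group (triangular_ring S M R)"
  proof (rule abelian_groupI)
    fix x assume "x \<in> carrier (triangular_ring S M R)"
    then obtain s m r where x: "x = (s, m, r)" "s \<in> carrier S" "m \<in> carrier M" "r \<in> carrier R"
      by (auto simp: triangular_ring_def)
    show "\<exists>y\<in>carrier (triangular_ring S M R).
        y \<oplus>\<^bsub>triangular_ring S M R\<^esub> x = \<zero>\<^bsub>triangular_ring S M R\<^esub>"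
      by (rule bexI[of _ "(\<ominus>\<^bsub>S\<^esub> s, \<ominus>\<^bsub>M\<^esub> m, \<ominus>\<^bsub>R\<^esub> r)"])
        (use x in \<open>auto simp: triangular_ring_def S.l_neg M.l_neg R.l_neg\<close>)
  qed (auto simp: triangular_ring_def S.add.m_ac M.add.m_ac R.add.m_ac)
next
  show "Group.monoid (triangular_ring S M R)"
    by (rule monoidI) (auto simp: triangular_ring_def lact_closed ract_closed S.m_assoc R.m_assoc
        lact_assoc ract_assoc lact_distr ract_distr lact_ract M.add.m_assoc
        lact_one ract_one lact_zero ract_zero)
qed (auto simp: triangular_ring_def lact_closed ract_closed S.l_distr S.r_distr R.l_distr R.r_distr
      lact_distr ract_distr lact_distr_scalar ract_distr_scalar M.add.m_ac)

text \<open>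
  Primeness for arbitrary associative rings, in terms of products of two-sided ideals. The library
  locale \<open>primeideal\<close> requires a commutative ring (and is elementwise).
\<close>

definition nc_prime_ideal :: "('a, 'b) ring_scheme \<Rightarrow> 'a set \<Rightarrow> bool"
  where "nc_prime_ideal R P \<longleftrightarrow> ideal P R \<and> P \<noteq> carrier R \<and>
    (\<forall>A B. ideal A R \<and> ideal B R \<and> ideal_prod R A B \<subseteq> P \<longrightarrow> A \<subseteq> P \<or> B \<subseteq> P)"

definition minimal_prime_ideal :: "('a, 'b) ring_scheme \<Rightarrow> 'a set \<Rightarrow> bool"
  where "minimal_prime_ideal R P \<longleftrightarrow> nc_prime_ideal R P \<and>
    (\<forall>Q. nc_prime_ideal R Q \<and> Q \<subseteq> P \<longrightarrow> Q = P)"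

text \<open>
  Minimality is among all prime ideals of the ring, not among those containing \<open>a\<close>.
  Intersecting with the carrier makes the empty intersection equal to the whole ring.
\<close>

definition min_prime_inter :: "('a, 'b) ring_scheme \<Rightarrow> 'a \<Rightarrow> 'a set"
  where "min_prime_inter R a = carrier R \<inter> \<Inter>{P. minimal_prime_ideal R P \<and> a \<in> P}"

definition z0_ideal :: "('a, 'b) ring_scheme \<Rightarrow> 'a set \<Rightarrow> bool"
  where "z0_ideal R I \<longleftrightarrow> ideal I R \<and> (\<forall>a\<in>I. min_prime_inter R a \<subseteq> I)"

end

(* A prime ideal of T contains one of the ideals 0 x M x R and S x M x 0, because their product
   (in this order) is zero. These are the kernels of the projections of T onto S and onto R, so the
   minimal primes of T are exactly the sets P x M x R and S x M x Q with P and Q minimal primes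
   of S and R. Hence P_(s,m,r) = P_s x M x P_r, and the theorem is read off from this formula. *)

theory Submission
  imports Defs "HOL-Algebra.QuotRing"
begin

section \<open>Prime ideals and surjective homomorphisms\<close>

lemma ideal_subset: "ideal J R \<Longrightarrow> J \<subseteq> carrier R"
  by (rule additive_subgroup.a_subset[OF ideal.axioms(1)])

text \<open>\<open>ideal_prod\<close> is generated inductively from products by sums, and an ideal
  \<open>P\<close> is closed under sums, so only the generators need testing. This turns primeness,
  stated with ideal products, into a condition on products of elements.\<close>

lemma ideal_prod_subset_iff:
  assumes "ideal P R"
  shows "ideal_prod R A B \<subseteq> P \<longleftrightarrow> (\<forall>a\<in>A. \<forall>b\<in>B. a \<otimes>\<^bsub>R\<^esub> b \<in> P)"
proof
  assume *: "\<forall>a\<in>A. \<forall>b\<in>B. a \<otimes>\<^bsub>R\<^esub> b \<in> P"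
  show "ideal_prod R A B \<subseteq> P"
  proof
    fix x assume "x \<in> ideal_prod R A B"
    then show "x \<in> P"
      by induction (use * assms in \<open>auto intro: additive_subgroup.a_closed ideal.axioms(1)\<close>)
  qed
qed (auto intro: ideal_prod.prod)

lemma nc_prime_idealD:
  assumes "nc_prime_ideal R P" "ideal A R" "ideal B R"
    and "\<And>a b. a \<in> A \<Longrightarrow> b \<in> B \<Longrightarrow> a \<otimes>\<^bsub>R\<^esub> b \<in> P"
  shows "A \<subseteq> P \<or> B \<subseteq> P"
  using assms by (simp add: nc_prime_ideal_def ideal_prod_subset_iff)

lemma nc_prime_idealI:
  assumes "ideal P R" "P \<noteq> carrier R"
    and "\<And>A B. \<lbrakk> ideal A R; ideal B R; \<And>a b. a \<in> A \<Longrightarrow> b \<in> B \<Longrightarrow> a \<otimes>\<^bsub>R\<^esub> b \<in> P \<rbrakk>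
      \<Longrightarrow> A \<subseteq> P \<or> B \<subseteq> P"
  shows "nc_prime_ideal R P"
  using assms by (simp add: nc_prime_ideal_def ideal_prod_subset_iff)

lemma nc_prime_ideal_subset: "nc_prime_ideal R P \<Longrightarrow> P \<subseteq> carrier R"
  by (simp add: nc_prime_ideal_def ideal_subset)

section \<open>Transfer of ideals and primes along a surjection\<close>

context ring_hom_ring
begin

text \<open>Surjectivity lifts each multiplier from \<open>S\<close> to \<open>R\<close>, where the
  ideal \<open>J\<close> absorbs it.\<close>

lemma ideal_image:
  assumes surj: "h ` carrier R = carrier S" and "ideal J R"
  shows "ideal (h ` J) S"
proof -
  interpret J: ideal J R by fact
  show ?thesis
  proof (rule idealI)
    show "ring S" ..
    show "subgroup (h ` J) (add_monoid S)"
      using img_is_add_subgroup[OF J.a_subgroup] .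
  next
    fix a x assume "a \<in> h ` J" "x \<in> carrier S"
    then obtain b y where *: "b \<in> J" "a = h b" "y \<in> carrier R" "x = h y"
      using surj by blast
    then have "x \<otimes>\<^bsub>S\<^esub> a = h (y \<otimes> b)" "a \<otimes>\<^bsub>S\<^esub> x = h (b \<otimes> y)"
      by (simp_all add: J.Icarr)
    moreover have "y \<otimes> b \<in> J" "b \<otimes> y \<in> J"
      using * by (simp_all add: J.I_l_closed J.I_r_closed)
    ultimately show "x \<otimes>\<^bsub>S\<^esub> a \<in> h ` J" "a \<otimes>\<^bsub>S\<^esub> x \<in> h ` J"
      by (simp_all only: imageI)
  qed
qed

text \<open>If \<open>h x = h y\<close> with \<open>y\<close> in \<open>J\<close>, then
  \<open>x\<close> differs from \<open>y\<close> by an element of the kernel, which lies in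
  \<open>J\<close>; hence \<open>x\<close> is in \<open>J\<close> as well.\<close>

lemma vimage_image_ideal:
  assumes "ideal J R" "a_kernel R S h \<subseteq> J"
  shows "{x \<in> carrier R. h x \<in> h ` J} = J"
proof -
  interpret J: ideal J R by fact
  have "x \<in> J" if "x \<in> carrier R" "y \<in> J" "h x = h y" for x y
  proof -
    have y: "y \<in> carrier R"
      using that(2) by (rule J.Icarr)
    have "h (x \<ominus> y) = \<zero>\<^bsub>S\<^esub>"
      using that(1) y by (simp add: R.minus_eq that(3) S.r_neg)
    with that(1) y have "x \<ominus> y \<in> a_kernel R S h"
      unfolding a_kernel_def' by blast
    then have "x \<ominus> y \<in> J"
      using assms(2) by blast
    then have "x \<ominus> y \<oplus> y \<in> J"
      using that(2) by (rule J.a_closed)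
    also have "x \<ominus> y \<oplus> y = x"
      using that(1) y by (simp add: R.minus_eq R.a_assoc R.l_neg)
    finally show ?thesis .
  qed
  then show ?thesis
    by (auto intro: J.Icarr)
qed

text \<open>By surjectivity the images of two ideals are again ideals, so the primeness of
  \<open>P\<close> applies to them. Properness pulls back because \<open>P\<close> cannot contain
  the whole image of \<open>h\<close>.\<close>

lemma nc_prime_ideal_vimage:
  assumes surj: "h ` carrier R = carrier S" and P: "nc_prime_ideal S P"
  shows "nc_prime_ideal R {x \<in> carrier R. h x \<in> P}"
proof (rule nc_prime_idealI)
  show "ideal {x \<in> carrier R. h x \<in> P} R"
    using P by (simp add: ideal_vimage nc_prime_ideal_def)
  show "{x \<in> carrier R. h x \<in> P} \<noteq> carrier R"
  proof
    assume "{x \<in> carrier R. h x \<in> P} = carrier R"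
    then have "h ` carrier R \<subseteq> P"
      by blast
    then show False
      using P nc_prime_ideal_subset[OF P] surj by (simp add: nc_prime_ideal_def)
  qed
next
  fix A B
  assume AB: "ideal A R" "ideal B R" "\<And>a b. a \<in> A \<Longrightarrow> b \<in> B \<Longrightarrow> a \<otimes> b \<in> {x \<in> carrier R. h x \<in> P}"
  have *: "A \<subseteq> carrier R" "B \<subseteq> carrier R"
    using AB(1,2) by (simp_all add: ideal_subset)
  have "h ` A \<subseteq> P \<or> h ` B \<subseteq> P"
  proof (rule nc_prime_idealD[OF P ideal_image[OF surj] ideal_image[OF surj]])
    fix a b assume "a \<in> h ` A" "b \<in> h ` B"
    then obtain x y where xy: "x \<in> A" "a = h x" "y \<in> B" "b = h y"
      by blast
    moreover have "h (x \<otimes> y) = h x \<otimes>\<^bsub>S\<^esub> h y"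
      using xy * by (intro hom_mult) auto
    ultimately show "a \<otimes>\<^bsub>S\<^esub> b \<in> P"
      using AB(3)[OF xy(1,3)] by simp
  qed (fact AB)+
  then show "A \<subseteq> {x \<in> carrier R. h x \<in> P} \<or> B \<subseteq> {x \<in> carrier R. h x \<in> P}"
    using * by blast
qed

text \<open>Primeness of \<open>Q\<close> is applied to the preimages of \<open>A\<close> and
  \<open>B\<close>. The kernel condition makes \<open>Q\<close> the full preimage of its image,
  which brings their products back into \<open>Q\<close>; surjectivity then returns the resulting
  inclusion to \<open>S\<close>.\<close>

lemma nc_prime_ideal_image:
  assumes surj: "h ` carrier R = carrier S" and Q: "nc_prime_ideal R Q"
    and ker: "a_kernel R S h \<subseteq> Q"
  shows "nc_prime_ideal S (h ` Q)"
proof (rule nc_prime_idealI)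
  have "ideal Q R"
    using Q by (simp add: nc_prime_ideal_def)
  note vim = vimage_image_ideal[OF this ker]
  show "ideal (h ` Q) S"
    using \<open>ideal Q R\<close> by (rule ideal_image[OF surj])
  show "h ` Q \<noteq> carrier S"
    using Q vim by (auto simp: nc_prime_ideal_def)
  fix A B
  assume AB: "ideal A S" "ideal B S" "\<And>a b. a \<in> A \<Longrightarrow> b \<in> B \<Longrightarrow> a \<otimes>\<^bsub>S\<^esub> b \<in> h ` Q"
  have "{x \<in> carrier R. h x \<in> A} \<subseteq> Q \<or> {x \<in> carrier R. h x \<in> B} \<subseteq> Q"
  proof (rule nc_prime_idealD[OF Q])
    fix a b assume "a \<in> {x \<in> carrier R. h x \<in> A}" "b \<in> {x \<in> carrier R. h x \<in> B}"
    then have "a \<otimes> b \<in> {x \<in> carrier R. h x \<in> h ` Q}"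
      using AB(3) by simp
    then show "a \<otimes> b \<in> Q"
      by (simp only: vim)
  qed (simp_all add: AB ideal_vimage)
  moreover have "A \<subseteq> h ` carrier R" "B \<subseteq> h ` carrier R"
    using AB(1,2) by (simp_all add: surj ideal_subset)
  ultimately show "A \<subseteq> h ` Q \<or> B \<subseteq> h ` Q"
    by blast
qed

end

section \<open>The triangular ring\<close>

context bimodule
begin

abbreviation T where "T \<equiv> triangular_ring S M R"

lemma carrier_T: "carrier T = carrier S \<times> carrier M \<times> carrier R"
  by (simp add: triangular_ring_def)

lemma carriers_nonempty: "carrier S \<noteq> {}" "carrier M \<noteq> {}" "carrier R \<noteq> {}"
  using S.zero_closed M.zero_closed R.zero_closed by blast+

lemma fst_hom: "ring_hom_ring T S fst"
  by (rule ring_hom_ringI[OF triangular_ring_is_ring S.ring_axioms])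
    (auto simp: triangular_ring_def)

lemma snd_snd_hom: "ring_hom_ring T R (snd \<circ> snd)"
  by (rule ring_hom_ringI[OF triangular_ring_is_ring R.ring_axioms])
    (auto simp: triangular_ring_def)

lemma fst_surj: "fst ` carrier T = carrier S"
  by (auto simp: carrier_T)

lemma snd_snd_surj: "(snd \<circ> snd) ` carrier T = carrier R"
proof -
  have "r \<in> (snd \<circ> snd) ` carrier T" if "r \<in> carrier R" for r
    by (rule image_eqI[of _ _ "(\<zero>\<^bsub>S\<^esub>, \<zero>\<^bsub>M\<^esub>, r)"]) (use that in \<open>simp_all add: carrier_T\<close>)
  then show ?thesis
    by (auto simp: carrier_T)
qed

lemma fst_vimage:
  "A \<subseteq> carrier S \<Longrightarrow> {x \<in> carrier T. fst x \<in> A} = A \<times> carrier M \<times> carrier R"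
  by (auto simp: carrier_T)

lemma snd_snd_vimage:
  "B \<subseteq> carrier R \<Longrightarrow> {x \<in> carrier T. (snd \<circ> snd) x \<in> B} = carrier S \<times> carrier M \<times> B"
  by (auto simp: carrier_T)

section \<open>Primes and minimal primes of \<open>T\<close>\<close>

lemma nc_prime_ideal_T_upper:
  assumes "nc_prime_ideal S P"
  shows "nc_prime_ideal T (P \<times> carrier M \<times> carrier R)"
  using ring_hom_ring.nc_prime_ideal_vimage[OF fst_hom fst_surj assms]
    fst_vimage[OF nc_prime_ideal_subset[OF assms]] by simp

lemma nc_prime_ideal_T_lower:
  assumes "nc_prime_ideal R Q"
  shows "nc_prime_ideal T (carrier S \<times> carrier M \<times> Q)"
  using ring_hom_ring.nc_prime_ideal_vimage[OF snd_snd_hom snd_snd_surj assms]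
    snd_snd_vimage[OF nc_prime_ideal_subset[OF assms]] by simp

lemma nc_prime_ideal_T_cases:
  assumes J: "nc_prime_ideal T J"
  obtains P where "nc_prime_ideal S P" "J = P \<times> carrier M \<times> carrier R"
  | Q where "nc_prime_ideal R Q" "J = carrier S \<times> carrier M \<times> Q"
proof -
  interpret f: ring_hom_ring T S fst by (rule fst_hom)
  interpret g: ring_hom_ring T R "snd \<circ> snd" by (rule snd_snd_hom)
  have id: "ideal J T"
    using J by (simp add: nc_prime_ideal_def)
  \<comment> \<open>The order matters: here the corner entry is \<open>0 m' + m 0\<close>, while the
    reversed product would have corner entry \<open>s m + m' r\<close>.\<close>
  have "x \<otimes>\<^bsub>T\<^esub> y = \<zero>\<^bsub>T\<^esub>" if "x \<in> a_kernel T S fst" "y \<in> a_kernel T R (snd \<circ> snd)" for x y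
  proof -
    from that obtain m r s m' where "x = (\<zero>\<^bsub>S\<^esub>, m, r)" "y = (s, m', \<zero>\<^bsub>R\<^esub>)"
      and "m \<in> carrier M" "r \<in> carrier R" "s \<in> carrier S" "m' \<in> carrier M"
      unfolding a_kernel_def' carrier_T by auto
    then show ?thesis
      by (simp add: triangular_ring_def lact_zero_scalar ract_zero_scalar)
  qed
  moreover have "\<zero>\<^bsub>T\<^esub> \<in> J"
    using id by (simp add: additive_subgroup.zero_closed ideal.axioms(1))
  ultimately consider "a_kernel T S fst \<subseteq> J" | "a_kernel T R (snd \<circ> snd) \<subseteq> J"
    using nc_prime_idealD[OF J f.kernel_is_ideal g.kernel_is_ideal] by metis
  then show thesis
  proof cases
    case 1
    have P: "nc_prime_ideal S (fst ` J)"
      using f.nc_prime_ideal_image[OF fst_surj J 1] .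
    \<comment> \<open>\<open>J\<close> contains the kernel, so it is the preimage of its image under
      the projection.\<close>
    have "J = fst ` J \<times> carrier M \<times> carrier R"
      using f.vimage_image_ideal[OF id 1] fst_vimage[OF nc_prime_ideal_subset[OF P]] by simp
    with P show thesis by (rule that(1))
  next
    case 2
    have Q: "nc_prime_ideal R ((snd \<circ> snd) ` J)"
      using g.nc_prime_ideal_image[OF snd_snd_surj J 2] .
    have "J = carrier S \<times> carrier M \<times> (snd \<circ> snd) ` J"
      using g.vimage_image_ideal[OF id 2] snd_snd_vimage[OF nc_prime_ideal_subset[OF Q]] by simp
    with Q show thesis by (rule that(2))
  qed
qed

text \<open>Inclusions inside one family reduce to inclusions of the varying factor, and a prime of
  one family never lies inside a prime of the other. So minimality in \<open>T\<close> is minimality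
  in \<open>S\<close> or in \<open>R\<close>.\<close>

lemma minimal_prime_ideal_T_iff:
  "minimal_prime_ideal T J \<longleftrightarrow>
    (\<exists>P. minimal_prime_ideal S P \<and> J = P \<times> carrier M \<times> carrier R) \<or>
    (\<exists>Q. minimal_prime_ideal R Q \<and> J = carrier S \<times> carrier M \<times> Q)"
    (is "_ \<longleftrightarrow> ?U \<or> ?L")
proof
  assume J: "minimal_prime_ideal T J"
  then have min: "\<And>K. nc_prime_ideal T K \<Longrightarrow> K \<subseteq> J \<Longrightarrow> K = J"
    by (simp add: minimal_prime_ideal_def)
  have "nc_prime_ideal T J"
    using J by (simp add: minimal_prime_ideal_def)
  then show "?U \<or> ?L"
  proof (cases rule: nc_prime_ideal_T_cases)
    case (1 P)
    \<comment> \<open>Minimality of \<open>J\<close> makes the two products equal; the common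
      factors cancel because the carriers are nonempty.\<close>
    have "P' = P" if "nc_prime_ideal S P'" "P' \<subseteq> P" for P'
      using min[OF nc_prime_ideal_T_upper[OF that(1)]] that(2) carriers_nonempty 1(2)
      by (auto simp: times_eq_iff)
    then have "minimal_prime_ideal S P"
      using 1(1) by (simp add: minimal_prime_ideal_def)
    with 1(2) show ?thesis by blast
  next
    case (2 Q)
    have "Q' = Q" if "nc_prime_ideal R Q'" "Q' \<subseteq> Q" for Q'
      using min[OF nc_prime_ideal_T_lower[OF that(1)]] that(2) carriers_nonempty 2(2)
      by (auto simp: times_eq_iff)
    then have "minimal_prime_ideal R Q"
      using 2(1) by (simp add: minimal_prime_ideal_def)
    with 2(2) show ?thesis by blast
  qed
next
  \<comment> \<open>An inclusion of products yields inclusions of the factors only when no factor on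
    the left is empty.\<close>
  have pne: "nc_prime_ideal S P \<Longrightarrow> P \<noteq> {}" "nc_prime_ideal R Q \<Longrightarrow> Q \<noteq> {}" for P Q
    unfolding nc_prime_ideal_def
    by (metis additive_subgroup.zero_closed empty_iff ideal.axioms(1))+
  assume "?U \<or> ?L"
  then show "minimal_prime_ideal T J"
  proof
    assume ?U
    then obtain P where P: "nc_prime_ideal S P" "J = P \<times> carrier M \<times> carrier R"
      and min: "\<And>P'. nc_prime_ideal S P' \<Longrightarrow> P' \<subseteq> P \<Longrightarrow> P' = P"
      by (auto simp: minimal_prime_ideal_def)
    have "K = J" if "nc_prime_ideal T K" "K \<subseteq> J" for K
      using that(1)
    proof (cases rule: nc_prime_ideal_T_cases)
      case (1 P')
      then show ?thesis
        using min[of P'] that(2) P(2) carriers_nonempty by (auto simp: times_subset_iff)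
    next
      case (2 Q)
      \<comment> \<open>A prime of the other family has the full \<open>carrier S\<close> as first
        factor, so its inclusion in \<open>J\<close> contradicts the properness of
        \<open>P\<close>.\<close>
      then have "carrier S \<subseteq> P"
        using that(2) P(2) carriers_nonempty pne(2)[OF 2(1)] by (auto simp: times_subset_iff)
      then show ?thesis
        using P(1) nc_prime_ideal_subset[OF P(1)] by (auto simp: nc_prime_ideal_def)
    qed
    then show ?thesis
      using nc_prime_ideal_T_upper[OF P(1)] P(2) by (simp add: minimal_prime_ideal_def)
  next
    assume ?L
    then obtain Q where Q: "nc_prime_ideal R Q" "J = carrier S \<times> carrier M \<times> Q"
      and min: "\<And>Q'. nc_prime_ideal R Q' \<Longrightarrow> Q' \<subseteq> Q \<Longrightarrow> Q' = Q"
      by (auto simp: minimal_prime_ideal_def)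
    have "K = J" if "nc_prime_ideal T K" "K \<subseteq> J" for K
      using that(1)
    proof (cases rule: nc_prime_ideal_T_cases)
      case (2 Q')
      then show ?thesis
        using min[of Q'] that(2) Q(2) carriers_nonempty by (auto simp: times_subset_iff)
    next
      case (1 P)
      then have "carrier R \<subseteq> Q"
        using that(2) Q(2) carriers_nonempty pne(1)[OF 1(1)] by (auto simp: times_subset_iff)
      then show ?thesis
        using Q(1) nc_prime_ideal_subset[OF Q(1)] by (auto simp: nc_prime_ideal_def)
    qed
    then show ?thesis
      using nc_prime_ideal_T_lower[OF Q(1)] Q(2) by (simp add: minimal_prime_ideal_def)
  qed
qed

text \<open>One family of minimal primes constrains only the first entry, the other only the last.
  If a family is empty, the intersection with the carrier in \<open>min_prime_inter\<close> supplies
  the full factor.\<close>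

lemma min_prime_inter_T:
  assumes "s \<in> carrier S" "m \<in> carrier M" "r \<in> carrier R"
  shows "min_prime_inter T (s, m, r) =
    min_prime_inter S s \<times> carrier M \<times> min_prime_inter R r"
proof -
  have eq: "{J. minimal_prime_ideal T J \<and> (s, m, r) \<in> J} =
      (\<lambda>P. P \<times> carrier M \<times> carrier R) ` {P. minimal_prime_ideal S P \<and> s \<in> P} \<union>
      (\<lambda>Q. carrier S \<times> carrier M \<times> Q) ` {Q. minimal_prime_ideal R Q \<and> r \<in> Q}"
    using assms by (auto simp: minimal_prime_ideal_T_iff)
  show ?thesis
  proof (rule Set.set_eqI)
    fix x :: "'s \<times> 'm \<times> 'r"
    obtain s' m' r' where x: "x = (s', m', r')"
      by (cases x)
    show "x \<in> min_prime_inter T (s, m, r) \<longleftrightarrow>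
        x \<in> min_prime_inter S s \<times> carrier M \<times> min_prime_inter R r"
      unfolding x min_prime_inter_def eq carrier_T by (simp add: ball_Un) blast
  qed
qed

end

lemma mem_min_prime_inter: "a \<in> carrier R \<Longrightarrow> a \<in> min_prime_inter R a"
  by (simp add: min_prime_inter_def)

theorem theorem4p9:
  fixes S :: "('s, 'x) ring_scheme" and R :: "('r, 'y) ring_scheme"
    and M :: "('s, 'm, 'r, 'z) bimodule_scheme"
    and I :: "'s set" and N :: "'m set" and L :: "'r set"
  assumes "ring S" and "carrier S \<noteq> {\<zero>\<^bsub>S\<^esub>}"
    and "ring R" and "carrier R \<noteq> {\<zero>\<^bsub>R\<^esub>}"
    and "bimodule S R M"
    and "ideal (I \<times> N \<times> L) (triangular_ring S M R)"
  shows "z0_ideal (triangular_ring S M R) (I \<times> N \<times> L) \<longleftrightarrow>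
    N = carrier M \<and> z0_ideal S I \<and> z0_ideal R L"
proof -
  interpret bimodule S R M by fact
  interpret J: ideal "I \<times> N \<times> L" T by fact
  \<comment> \<open>These zeros show that no factor is empty, and later serve as test values in the
    quantified statement.\<close>
  have zero: "\<zero>\<^bsub>S\<^esub> \<in> I" "\<zero>\<^bsub>M\<^esub> \<in> N" "\<zero>\<^bsub>R\<^esub> \<in> L"
    using additive_subgroup.zero_closed[OF J.additive_subgroup_axioms]
    by (auto simp: triangular_ring_def)
  have sub: "I \<subseteq> carrier S" "N \<subseteq> carrier M" "L \<subseteq> carrier R"
    using J.a_subset zero by (auto simp: carrier_T times_subset_iff)
  \<comment> \<open>Projecting the product recovers \<open>I\<close> and \<open>L\<close>, which
    makes them ideals as images under surjections.\<close>
  have "fst ` (I \<times> N \<times> L) = I" "(snd \<circ> snd) ` (I \<times> N \<times> L) = L"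
    using zero by force+
  then have id: "ideal I S" "ideal L R"
    using ring_hom_ring.ideal_image[OF fst_hom fst_surj J.ideal_axioms]
      ring_hom_ring.ideal_image[OF snd_snd_hom snd_snd_surj J.ideal_axioms] by simp_all
  have "z0_ideal T (I \<times> N \<times> L) \<longleftrightarrow>
      (\<forall>s\<in>I. \<forall>m\<in>N. \<forall>r\<in>L. min_prime_inter T (s, m, r) \<subseteq> I \<times> N \<times> L)"
    using J.ideal_axioms by (auto simp: z0_ideal_def)
  also have "\<dots> \<longleftrightarrow> (\<forall>s\<in>I. \<forall>m\<in>N. \<forall>r\<in>L.
      min_prime_inter S s \<times> carrier M \<times> min_prime_inter R r \<subseteq> I \<times> N \<times> L)"
    by (simp add: min_prime_inter_T sub[THEN subsetD])
  also have "\<dots> \<longleftrightarrow> (\<forall>s\<in>I. \<forall>m\<in>N. \<forall>r\<in>L.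
      min_prime_inter S s \<subseteq> I \<and> carrier M \<subseteq> N \<and> min_prime_inter R r \<subseteq> L)"
  \<comment> \<open>Since \<open>s\<close> lies in \<open>min_prime_inter S s\<close>, and likewise
    for \<open>r\<close>, all factors on the left are nonempty and the inclusion splits.\<close>
  proof (intro ball_cong refl)
    fix s m r assume "s \<in> I" "m \<in> N" "r \<in> L"
    then have "min_prime_inter S s \<noteq> {}" "carrier M \<noteq> {}" "min_prime_inter R r \<noteq> {}"
      using sub mem_min_prime_inter[of s S] mem_min_prime_inter[of r R] by auto
    then show "min_prime_inter S s \<times> carrier M \<times> min_prime_inter R r \<subseteq> I \<times> N \<times> L \<longleftrightarrow>
        min_prime_inter S s \<subseteq> I \<and> carrier M \<subseteq> N \<and> min_prime_inter R r \<subseteq> L"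
      by (auto simp: times_subset_iff)
  qed
  \<comment> \<open>Each conjunct involves at most one of \<open>s\<close>, \<open>m\<close>,
    \<open>r\<close>; putting zero for the other variables separates the conditions.\<close>
  also have "\<dots> \<longleftrightarrow> N = carrier M \<and> z0_ideal S I \<and> z0_ideal R L"
    using zero sub id unfolding z0_ideal_def by blast
  finally show ?thesis .
qed

end
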